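(* Let $\mathcal{A}:\mathcal{S}^n\times\mathbb{R}^n\to\mathbb{R}^m$ be the linear map with components $\mathcal{A}(\mathsf{X},\mathbf{x})_i=\mathsf{A}_i\bullet\mathsf{X}+\mathbf{a}_i^{\mathsf T}\mathbf{x}$, $i=1,\dots,m$, for some $\mathsf{A}_i\in\mathcal{S}^n$, $\mathbf{a}_i\in\mathbb{R}^n$, satisfying $\{\mathsf{X}\in\mathcal{S}^n_+:\mathcal{A}(\mathsf{X},\mathbf{0})=\mathbf{0}\}=\{\mathsf{O}\}$, let $\mathbf{b}\in\mathbb{R}^m$, and let $\mathcal{X}=\{\mathbf{x}\in\mathbb{R}^n:\mathcal{A}(\mathbf{x}\mathbf{x}^{\mathsf T},\mathbf{x})=\mathbf{b}\}$. Let $$f(\mathbf{x})=\mathbf{x}^{\mathsf T}\mathsf{A}\mathbf{x}+2\mathbf{a}^{\mathsf T}\mathbf{x}+\max_{\mathbf{u}\in\mathbb{R}^q}\{2\mathbf{u}^{\mathsf T}\mathsf{B}\mathbf{x}+\mathbf{u}^{\mathsf T}\mathsf{C}\mathbf{u}+2\mathbf{c}^{\mathsf T}\mathbf{u}:\mathbf{u}\in\mathcal{U}\},\qquad\mathbf{x}\in\mathbb{R}^n,$$ where $\mathcal{U}\subseteq\mathbb{R}^q$ is nonempty, compact and convex, $\mathsf{A}\in\mathcal{S}^n$, $\mathsf{B}\in\mathbb{R}^{q\times n}$, $\mathsf{C}\in\mathcal{S}^q$, $\mathbf{a}\in\mathbb{R}^n$, $\mathbf{c}\in\mathbb{R}^q$.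 Let $\mathcal{C}\subseteq\mathcal{S}^{n+q+1}$ be a closed convex set with $\mathcal{S}^{n+q+1}_+\supseteq\mathcal{C}\supseteq\mathcal{G}(\mathcal{U}\times\mathcal{X})$ and define $$g(\mathbf{x})=\sup_{\Psi,\mathbf{u},\mathsf{U},\mathsf{X}}\left\{\begin{array}{l}\mathsf{A}\bullet\mathsf{X}+2\mathbf{a}^{\mathsf T}\mathbf{x}+2\mathsf{B}^{\mathsf T}\bullet\Psi+\mathsf{C}\bullet\mathsf{U}+2\mathbf{c}^{\mathsf T}\mathbf{u}\ :\\[2pt] \begin{bmatrix}1&\mathbf{u}^{\mathsf T}&\mathbf{x}^{\mathsf T}\\ \mathbf{u}&\mathsf{U}&\Psi^{\mathsf T}\\ \mathbf{x}&\Psi&\mathsf{X}\end{bmatrix}\in\mathcal{C},\ \begin{bmatrix}1&\mathbf{u}^{\mathsf T}\\ \mathbf{u}&\mathsf{U}\end{bmatrix}\in\mathcal{G}(\mathcal{U}),\ \mathcal{A}(\mathsf{X},\mathbf{x})=\mathbf{b}\end{array}\right\},$$ where $\Psi\in\mathbb{R}^{n\times q}$, $\mathbf{u}\in\mathbb{R}^q$, $\mathsf{U}\in\mathcal{S}^q$, $\mathsf{X}\in\mathcal{S}^n$. For $\boldsymbol{\lambda}\in\mathbb{R}^m$ let $g_c(\mathbf{x},\boldsymbol{\lambda})=f(\mathbf{x})-\boldsymbol{\lambda}^{\mathsf T}(\mathcal{A}(\mathbf{x}\mathbf{x}^{\mathsf T},\mathbf{x})-\mathbf{b})$, and let $\mathcal{T}=\{\boldsymbol{\lambda}\in\mathbb{R}^m: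 g_c(\cdot,\boldsymbol{\lambda})\text{ is concave}\}$. Then $$g(\mathbf{x})\le g_c(\mathbf{x},\boldsymbol{\lambda})\qquad\text{for all }\mathbf{x}\in\mathbb{R}^n\text{ and all }\boldsymbol{\lambda}\in\mathcal{T}.$$
   Context: $\mathcal{S}^d$ is the space of symmetric $d\times d$ matrices, $\mathcal{S}^d_+$ the cone of positive semidefinite ones, $\mathsf{O}$ the zero matrix, $\mathsf{M}\bullet\mathsf{N}=\operatorname{Tr}(\mathsf{M}^{\mathsf T}\mathsf{N})$. For $\mathcal{F}\subseteq\mathbb{R}^d$, $\mathcal{G}(\mathcal{F})\subseteq\mathcal{S}^{d+1}$ is the closure of the convex hull of $\left\{\begin{bmatrix}1\\ \mathbf{y}\end{bmatrix}\begin{bmatrix}1\\ \mathbf{y}\end{bmatrix}^{\mathsf T}:\mathbf{y}\in\mathcal{F}\right\}$; elements of $\mathcal{U}\times\mathcal{X}$ are vectors $(\mathbf{u}^{\mathsf T},\mathbf{x}^{\mathsf T})^{\mathsf T}\in\mathbb{R}^{q+n}$. Convention: $\sup\emptyset=-\infty$. *)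

theory Defs
  imports "HOL-Analysis.Analysis"
begin

definition sym_mats :: "(real^'d^'d) set" where
  "sym_mats = {M. transpose M = M}"

definition psd_mats :: "(real^'d^'d) set" where
  "psd_mats = {M \<in> sym_mats. \<forall>v. 0 \<le> v \<bullet> (M *v v)}"

definition mat_inner :: "real^'n^'m \<Rightarrow> real^'n^'m \<Rightarrow> real"  (infixl "\<odot>" 70) where
  "M \<odot> N = trace (transpose M ** N)"

definition outer_prod :: "real^'m \<Rightarrow> real^'n \<Rightarrow> real^'n^'m" where
  "outer_prod v w = (\<chi> i j. v $ i * w $ j)"

text \<open>
  \<^typ>\<open>real^('a + 'b)\<close> plays the role of the space of dimension
  \<^term>\<open>CARD('a) + CARD('b)\<close>, the components indexed by the left summand coming first.
  Accordingly an extra leading coordinate is indexed by the type \<^typ>\<open>unit\<close>.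
\<close>

definition vstack :: "real^'a \<Rightarrow> real^'b \<Rightarrow> real^('a + 'b)" where
  "vstack v w = (\<chi> i. case i of Inl k \<Rightarrow> v $ k | Inr k \<Rightarrow> w $ k)"

definition block_mat ::
  "real^'c^'a \<Rightarrow> real^'d^'a \<Rightarrow> real^'c^'b \<Rightarrow> real^'d^'b \<Rightarrow> real^('c + 'd)^('a + 'b)" where
  "block_mat P Q R S =
     (\<chi> i. case i of Inl k \<Rightarrow> vstack (P $ k) (Q $ k) | Inr k \<Rightarrow> vstack (R $ k) (S $ k))"

text \<open>The matrix with first row $(1, v^T)$, first column $(1, v)$ and remaining block $M$.\<close>

definition bordered :: "real^'d \<Rightarrow> real^'d^'d \<Rightarrow> real^(unit + 'd)^(unit + 'd)" where
  "bordered v M = block_mat (mat 1) (\<chi> i. v) (\<chi> i j. v $ i) M"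

definition lift_hull :: "(real^'d) set \<Rightarrow> (real^(unit + 'd)^(unit + 'd)) set" where
  "lift_hull F =
     closure (convex hull ((\<lambda>y. outer_prod (vstack (vec 1) y) (vstack (vec 1) y)) ` F))"

definition stacked_times :: "(real^'a) set \<Rightarrow> (real^'b) set \<Rightarrow> (real^('a + 'b)) set" where
  "stacked_times S T = {vstack s t | s t. s \<in> S \<and> t \<in> T}"

definition quad_op ::
  "('m \<Rightarrow> real^'n^'n) \<Rightarrow> ('m \<Rightarrow> real^'n) \<Rightarrow> real^'n^'n \<Rightarrow> real^'n \<Rightarrow> real^'m" where
  "quad_op As as X x = (\<chi> i. As i \<odot> X + as i \<bullet> x)"

text \<open>
  A maximum of a continuous function over a nonempty compact set is written with the real
  supremum; the next fact shows that it is indeed attained.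
\<close>

lemma SUP_compact_is_max:
  fixes h :: "'a::topological_space \<Rightarrow> real"
  assumes "compact S" "S \<noteq> {}" "continuous_on S h"
  shows "\<exists>u\<in>S. (\<forall>v\<in>S. h v \<le> h u) \<and> (SUP v\<in>S. h v) = h u"
proof -
  obtain u where u: "u \<in> S" "\<forall>v\<in>S. h v \<le> h u"
    using continuous_attains_sup[OF assms] by blast
  then have "(SUP v\<in>S. h v) = h u"
    by (intro cSup_eq_maximum) auto
  with u show ?thesis by blast
qed

end

theory Submission
  imports Defs
begin

text \<open>
  If the lifted matrix were the moment matrix of a random pair \<open>(u, y)\<close> with \<open>u\<close> in
  \<open>UU\<close> and mean \<open>y\<close> equal to \<open>x\<close>, the relaxed objective would be an expected value
  bounded by the mean of \<open>gc y l\<close>, and Jensen's inequality for the concave function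
  \<open>gc _ l\<close> would finish. Such a random pair need not exist exactly, so the argument runs on
  the dual side.

  Fix \<open>l\<close> in \<open>TT\<close>. A supergradient \<open>d\<close> of \<open>gc _ l\<close> at \<open>x\<close>
  (\<open>concave_on_supergradient\<close>) bounds \<open>gc y l\<close> by an affine function of \<open>y\<close>. Each \<open>w\<close> in
  \<open>UU\<close> gives a lower bound for the supremum inside \<open>gc y l\<close>; hence the difference between
  the affine bound and the quadratic in \<open>(w, y)\<close> obtained from \<open>w\<close> is nonnegative for all
  \<open>w\<close> in \<open>UU\<close> and all \<open>y\<close>. Integrating this quadratic against the lifted matrix gives exactly
  \<open>gc x l\<close> minus the relaxed objective: the supergradient term vanishes because the first
  column carries \<open>x\<close>, and the multipliers disappear because \<open>quad_op As as X x = b\<close>.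

  It remains to see that the integral is nonnegative, although the lifted matrix is only known to
  be positive semidefinite with its \<open>(1, u)\<close> block in \<open>lift_hull UU\<close>. Write the matrix as a sum
  of outer products of vectors \<open>(t, v, y)\<close> (\<open>psd_imp_sum_outer_prod\<close>). Completing the square in
  \<open>y\<close>, after an arbitrarily small perturbation if necessary, splits the quadratic into a nonnegative square and a form in \<open>(t, v)\<close> alone. The latter is
  the minimum of the quadratic over \<open>y\<close>, so it is nonnegative on \<open>(1, u)\<close> for \<open>u\<close> in \<open>UU\<close>, and
  therefore its linear extension to matrices is nonnegative on \<open>lift_hull UU\<close>. This is \<open>sum_quadratic_nonneg_fibred\<close>.
\<close>

section \<open>Symmetric matrices and rank-one matrices\<close>

lemma mat_inner_eq_inner: "M \<odot> N = M \<bullet> N"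
  by (simp add: mat_inner_def trace_def matrix_matrix_mult_def transpose_def inner_vec_def)
     (rule sum.swap)

lemma inner_outer_prod: "K \<bullet> outer_prod v w = v \<bullet> (K *v w)"
  by (simp add: outer_prod_def inner_vec_def matrix_vector_mult_def sum_distrib_left mult_ac)

lemma outer_prod_mult_vec: "outer_prod v w *v x = (w \<bullet> x) *\<^sub>R v"
  by (simp add: vec_eq_iff outer_prod_def inner_vec_def matrix_vector_mult_def
      sum_distrib_left sum_distrib_right mult_ac)

lemma scaleR_outer_prod: "outer_prod (r *\<^sub>R v) (r *\<^sub>R v) = r\<^sup>2 *\<^sub>R outer_prod v v"
  by (simp add: vec_eq_iff outer_prod_def power2_eq_square)

lemma transpose_outer_prod: "transpose (outer_prod v v) = outer_prod v v"
  by (simp add: vec_eq_iff outer_prod_def transpose_def mult.commute)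

lemma sym_mats_inner:
  assumes "M \<in> sym_mats" shows "v \<bullet> (M *v w) = w \<bullet> (M *v v)"
proof -
  have "v \<bullet> (M *v w) = (transpose M *v v) \<bullet> w"
    by (simp add: dot_lmul_matrix [symmetric])
  also have "\<dots> = w \<bullet> (M *v v)"
    using assms by (simp add: sym_mats_def inner_commute)
  finally show ?thesis .
qed

lemma sym_mats_diff: "M \<in> sym_mats \<Longrightarrow> N \<in> sym_mats \<Longrightarrow> M - N \<in> sym_mats"
  and sym_mats_add: "M \<in> sym_mats \<Longrightarrow> N \<in> sym_mats \<Longrightarrow> M + N \<in> sym_mats"
  and sym_mats_scaleR: "M \<in> sym_mats \<Longrightarrow> r *\<^sub>R M \<in> sym_mats"
  and sym_mats_zero: "0 \<in> sym_mats"
  by (auto simp: sym_mats_def transpose_def vec_eq_iff)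

lemma sym_mats_sum: "(\<And>i. i \<in> I \<Longrightarrow> M i \<in> sym_mats) \<Longrightarrow> sum M I \<in> sym_mats"
  by (induction I rule: infinite_finite_induct) (auto simp: sym_mats_zero sym_mats_add)

text \<open>Polarisation: a symmetric bilinear form is determined by its quadratic form.\<close>

lemma quadratic_form_eq_0_imp:
  assumes "M \<in> sym_mats" and "\<And>v. v \<bullet> (M *v v) = 0"
  shows "M = 0"
proof -
  have "v \<bullet> (M *v w) = 0" for v w
    using assms(2)[of "v + w"] assms(2)[of v] assms(2)[of w] sym_mats_inner[OF assms(1), of v w]
    by (simp add: matrix_vector_right_distrib inner_simps)
  then have "M *v w = 0" for w
    using inner_eq_zero_iff by blast
  then show ?thesis
    by (simp add: matrix_eq)
qed

text \<open>
  Split off one rank-one piece at a time: if \<open>p \<bullet> (M *v p) > 0\<close>, subtracting the multiple of the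
  outer square of \<open>M *v p\<close> that puts \<open>p\<close> into the kernel leaves the rest positive semidefinite
  and keeps the old kernel, so the kernel grows strictly.
\<close>

lemma psd_imp_sum_outer_prod:
  fixes M :: "real^'d^'d"
  assumes "M \<in> psd_mats"
  shows "\<exists>(m::nat) v. M = (\<Sum>k<m. outer_prod (v k) (v k))"
  using assms
proof (induction "CARD('d) - dim {w. M *v w = 0}" arbitrary: M rule: less_induct)
  case less
  note M = less.prems
  have sym: "M \<in> sym_mats" and nonneg: "\<And>w. 0 \<le> w \<bullet> (M *v w)"
    using M by (auto simp: psd_mats_def)
  show ?case
  proof (cases "M = 0")
    case True
    then show ?thesis by (intro exI[of _ 0]) simp
  next
    case False
    then obtain p where "p \<bullet> (M *v p) \<noteq> 0"
      using quadratic_form_eq_0_imp[OF sym] by blast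
    define r where "r = p \<bullet> (M *v p)"
    with \<open>p \<bullet> (M *v p) \<noteq> 0\<close> nonneg[of p] have r: "r > 0" by (simp add: r_def)
    define N where "N = M - (1/r) *\<^sub>R outer_prod (M *v p) (M *v p)"
    have N_mult: "N *v w = M *v w - ((p \<bullet> (M *v w)) / r) *\<^sub>R (M *v p)" for w
      by (simp add: N_def matrix_vector_mult_diff_rdistrib outer_prod_mult_vec
          scaleR_matrix_vector_assoc[symmetric] sym_mats_inner[OF sym, of p w] inner_commute)
    have "N \<in> psd_mats"
    proof -
      have "0 \<le> w \<bullet> (N *v w)" for w
      proof -
        define t where "t = (p \<bullet> (M *v w)) / r"
        \<comment> \<open>\<open>w - t *\<^sub>R p\<close> is the component of \<open>w\<close> that is orthogonal to \<open>p\<close> for the form of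
          \<open>M\<close>.\<close>
        have "w \<bullet> (N *v w) = (w - t *\<^sub>R p) \<bullet> (M *v (w - t *\<^sub>R p))"
          using r sym_mats_inner[OF sym, of w p]
          by (simp add: N_mult t_def matrix_vector_mult_diff_distrib matrix_vector_mult_scaleR
              inner_simps field_simps r_def[symmetric])
        then show ?thesis using nonneg by simp
      qed
      moreover have "N \<in> sym_mats"
        unfolding N_def
        by (intro sym_mats_diff sym sym_mats_scaleR) (simp add: sym_mats_def transpose_outer_prod)
      ultimately show ?thesis by (simp add: psd_mats_def)
    qed
    moreover have "dim {w. M *v w = 0} < dim {w. N *v w = 0}"
    proof (rule dim_psubset)
      have sub: "subspace {w. K *v w = 0}" for K :: "real^'d^'d"
        by (auto simp: subspace_def matrix_vector_right_distrib matrix_vector_mult_scaleR)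
      have "p \<in> {w. N *v w = 0}" "p \<notin> {w. M *v w = 0}"
        using r by (auto simp: N_mult r_def)
      then show "span {w. M *v w = 0} \<subset> span {w. N *v w = 0}"
        unfolding span_eq_iff[THEN iffD2, OF sub] by (auto simp: N_mult)
    qed
    moreover have "dim {w. N *v w = 0} \<le> CARD('d)"
      using dim_subset_UNIV_cart by blast
    ultimately obtain m v where v: "N = (\<Sum>k<m::nat. outer_prod (v k) (v k))"
      using less.hyps[of N] by force
    have "M = N + outer_prod ((1 / sqrt r) *\<^sub>R (M *v p)) ((1 / sqrt r) *\<^sub>R (M *v p))"
      using r unfolding scaleR_outer_prod by (simp add: N_def power_divide)
    also have "\<dots> = (\<Sum>k<Suc m. outer_prod ((v(m := (1 / sqrt r) *\<^sub>R (M *v p))) k)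
                                        ((v(m := (1 / sqrt r) *\<^sub>R (M *v p))) k))"
      by (simp add: v)
    finally show ?thesis by blast
  qed
qed

section \<open>Supergradients\<close>

text \<open>
  Separate the point \<open>(x, \<phi> x)\<close> from the strict hypograph of \<open>\<phi>\<close>. Since \<open>\<phi>\<close> is finite
  everywhere, the separating hyperplane cannot be vertical, so it is the graph of an affine
  function.
\<close>

lemma concave_on_supergradient:
  fixes \<phi> :: "'a::euclidean_space \<Rightarrow> real"
  assumes "concave_on UNIV \<phi>"
  obtains d where "\<And>y. \<phi> y \<le> \<phi> x + d \<bullet> (y - x)"
proof -
  define H where "H = {(y, t). t < \<phi> y}"
  have "convex H"
  proof (rule convexI)
    fix p q :: "'a \<times> real" and \<mu> \<nu> :: real
    assume *: "p \<in> H" "q \<in> H" "0 \<le> \<mu>" "0 \<le> \<nu>" "\<mu> + \<nu> = 1"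
    obtain y t y' t' where pq: "p = (y, t)" "q = (y', t')" by force
    have "\<mu> * t + \<nu> * t' < \<mu> * \<phi> y + \<nu> * \<phi> y'"
    proof (cases "\<mu> = 0")
      case True with * pq show ?thesis by (simp add: H_def)
    next
      case False
      with * pq have "\<mu> * t < \<mu> * \<phi> y" "\<nu> * t' \<le> \<nu> * \<phi> y'"
        by (auto simp: H_def intro: mult_left_mono)
      then show ?thesis by simp
    qed
    also have "\<dots> \<le> \<phi> (\<mu> *\<^sub>R y + \<nu> *\<^sub>R y')"
      using * assms by (auto simp: concave_on_iff)
    finally show "\<mu> *\<^sub>R p + \<nu> *\<^sub>R q \<in> H"
      by (simp add: pq H_def)
  qed
  moreover have "(x, \<phi> x - 1) \<in> H" "H \<inter> {(x, \<phi> x)} = {}"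
    by (auto simp: H_def)
  ultimately obtain n \<beta> where n: "n \<noteq> 0" "\<forall>p\<in>H. n \<bullet> p \<le> \<beta>" "\<beta> \<le> n \<bullet> (x, \<phi> x)"
    using separating_hyperplane_sets[of H "{(x, \<phi> x)}"] by blast
  obtain s \<tau> where s: "n = (s, \<tau>)" by force
  have sep: "s \<bullet> y + \<tau> * t \<le> s \<bullet> x + \<tau> * \<phi> x" if "t < \<phi> y" for y t
    using n(2,3) that s by (fastforce simp: H_def)
  have "\<tau> > 0"
  proof -
    have "\<tau> \<ge> 0"
      using sep[of "\<phi> x - 1" x] by (simp add: algebra_simps)
    moreover have "\<tau> \<noteq> 0"
    proof
      \<comment> \<open>A vertical hyperplane is violated by moving from \<open>x\<close> in its normal direction.\<close>
      assume "\<tau> = 0"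
      then have "s \<bullet> s \<le> 0"
        using sep[of "\<phi> (x + s) - 1" "x + s"] by (simp add: inner_simps)
      then have "s = 0" by (metis inner_gt_zero_iff not_less)
      with n(1) s \<open>\<tau> = 0\<close> show False by (simp add: zero_prod_def)
    qed
    ultimately show ?thesis by simp
  qed
  have "\<phi> y \<le> \<phi> x + (- (1/\<tau>) *\<^sub>R s) \<bullet> (y - x)" for y
  proof (rule dense_le)
    fix t assume "t < \<phi> y"
    then show "t \<le> \<phi> x + (- (1/\<tau>) *\<^sub>R s) \<bullet> (y - x)"
      using sep[of t y] \<open>\<tau> > 0\<close> by (simp add: field_simps inner_simps)
  qed
  then show ?thesis by (rule that)
qed

section \<open>Quadratics that are nonnegative on a cylinder\<close>

lemma quadratic_nonneg_imp_leading_coeff_nonneg: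
  fixes \<alpha> \<beta> \<gamma> :: real
  assumes "\<And>t. 0 \<le> \<alpha> * t\<^sup>2 + \<beta> * t + \<gamma>"
  shows "0 \<le> \<alpha>"
proof (rule ccontr)
  assume "\<not> 0 \<le> \<alpha>"
  then have a: "\<alpha> < 0" by simp
  \<comment> \<open>Averaging over \<open>t\<close> and \<open>- t\<close> removes the linear term.\<close>
  have "0 \<le> \<alpha> * t\<^sup>2 + \<gamma>" for t
    using assms[of t] assms[of "- t"] by simp
  moreover have "\<alpha> * (sqrt ((\<bar>\<gamma>\<bar> + 1) / - \<alpha>))\<^sup>2 = - (\<bar>\<gamma>\<bar> + 1)"
    using a by (subst real_sqrt_pow2) (auto simp: field_simps)
  ultimately show False
    by (smt (verit))
qed

text \<open>
  A linear functional that is nonnegative on the generators stays so on their closed convex hull,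
  because its nonnegativity set is a closed half-space.
\<close>

lemma closure_hull_outer_prod_nonneg:
  fixes K :: "real^'p^'p"
  assumes "Z \<in> closure (convex hull ((\<lambda>z. outer_prod z z) ` G))"
    and "\<And>z. z \<in> G \<Longrightarrow> 0 \<le> z \<bullet> (K *v z)"
  shows "0 \<le> K \<bullet> Z"
proof -
  have "closure (convex hull ((\<lambda>z. outer_prod z z) ` G)) \<subseteq> {W. K \<bullet> W \<ge> 0}"
    using assms(2)
    by (intro closure_minimal hull_minimal closed_halfspace_ge convex_halfspace_ge)
       (auto simp: inner_outer_prod)
  with assms(1) show ?thesis by blast
qed

text \<open>
  For invertible \<open>P\<close>, minimising over \<open>y\<close> yields the Schur complement \<open>T\<close>, a quadratic form in
  \<open>z\<close> alone which is nonnegative on \<open>G\<close>, and the quadratic dominates it everywhere. Only the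
  points \<open>z \<in> G\<close> are tested in the hypothesis, whereas the \<open>z k\<close> are arbitrary: they enter the
  lower bound only through the sum of their outer squares. A singular \<open>P\<close> is perturbed
  to \<open>P + \<epsilon> *\<^sub>R mat 1\<close>, which keeps the hypothesis, and \<open>\<epsilon>\<close> tends to zero at the end.
\<close>

lemma sum_quadratic_nonneg_fibred:
  fixes P :: "real^'n^'n" and R :: "real^'p^'n" and S :: "real^'p^'p"
    and z :: "'i \<Rightarrow> real^'p" and y :: "'i \<Rightarrow> real^'n"
  assumes P: "P \<in> sym_mats" and "G \<noteq> {}"
    and nonneg: "\<And>z y. z \<in> G \<Longrightarrow> 0 \<le> y \<bullet> (P *v y) + 2 * (y \<bullet> (R *v z)) + z \<bullet> (S *v z)"
    and Z: "(\<Sum>k\<in>I. outer_prod (z k) (z k)) \<in> closure (convex hull ((\<lambda>z. outer_prod z z) ` G))"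
  shows "0 \<le> (\<Sum>k\<in>I. y k \<bullet> (P *v y k) + 2 * (y k \<bullet> (R *v z k)) + z k \<bullet> (S *v z k))"
proof -
  have psd: "0 \<le> w \<bullet> (P *v w)" for w
  proof -
    from \<open>G \<noteq> {}\<close> obtain \<zeta> where "\<zeta> \<in> G" by blast
    then have "0 \<le> (w \<bullet> (P *v w)) * t\<^sup>2 + (2 * (w \<bullet> (R *v \<zeta>))) * t + \<zeta> \<bullet> (S *v \<zeta>)" for t
      using nonneg[of \<zeta> "t *\<^sub>R w"]
      by (simp add: matrix_vector_mult_scaleR power2_eq_square mult_ac)
    then show ?thesis by (rule quadratic_nonneg_imp_leading_coeff_nonneg)
  qed
  have perturbed: "0 \<le> (\<Sum>k\<in>I. y k \<bullet> (P *v y k) + 2 * (y k \<bullet> (R *v z k)) + z k \<bullet> (S *v z k))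
      + \<epsilon> * (\<Sum>k\<in>I. y k \<bullet> y k)" if "\<epsilon> > 0" for \<epsilon>
  proof -
    define E where "E = P + \<epsilon> *\<^sub>R mat 1"
    have E_mult: "E *v w = P *v w + \<epsilon> *\<^sub>R w" for w
      by (simp add: E_def matrix_vector_mult_add_rdistrib scaleR_matrix_vector_assoc[symmetric])
    have E_form: "v \<bullet> (E *v w) = v \<bullet> (P *v w) + \<epsilon> * (v \<bullet> w)" for v w
      by (simp add: E_mult inner_simps)
    have "w = 0" if "E *v w = 0" for w
    proof -
      have "\<epsilon> * (w \<bullet> w) \<le> 0"
        using E_form[of w w] that psd[of w] by simp
      then show ?thesis
        using \<open>\<epsilon> > 0\<close> by (metis inner_gt_zero_iff mult_pos_pos not_less)
    qed
    then obtain N where "N ** E = mat 1"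
      using matrix_left_invertible_ker by blast
    then have N: "E ** N = mat 1"
      by (rule matrix_left_right_inverse[THEN iffD1])
    define L where "L = N ** R"
    have EL: "E *v (L *v w) = R *v w" for w
      by (simp add: L_def matrix_vector_mul_assoc matrix_mul_assoc N)
    define T where "T = S - transpose L ** R"
    have T_form: "w \<bullet> (T *v w) = w \<bullet> (S *v w) - (L *v w) \<bullet> (R *v w)" for w
    proof -
      have "w \<bullet> (transpose L *v (R *v w)) = (L *v w) \<bullet> (R *v w)"
        by (metis dot_lmul_matrix inner_commute transpose_matrix_vector)
      then show ?thesis
        by (simp add: T_def matrix_vector_mult_diff_rdistrib inner_diff_right
            matrix_vector_mul_assoc[symmetric] del: transpose_matrix_vector)
    qed
    have square: "v \<bullet> (E *v v) + 2 * (v \<bullet> (R *v w)) + w \<bullet> (S *v w)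
        = (v + L *v w) \<bullet> (E *v (v + L *v w)) + w \<bullet> (T *v w)" for v w
    proof -
      have "(L *v w) \<bullet> (E *v v) = v \<bullet> (R *v w)"
        using sym_mats_inner[OF P, of "L *v w" v] E_form[of v "L *v w"] E_form[of "L *v w" v]
        by (simp add: EL inner_commute)
      then show ?thesis
        by (simp add: matrix_vector_right_distrib EL inner_simps T_form)
    qed
    have E_nonneg: "0 \<le> w \<bullet> (E *v w)" for w
      using psd[of w] \<open>\<epsilon> > 0\<close> by (simp add: E_form)
    have "0 \<le> T \<bullet> (\<Sum>k\<in>I. outer_prod (z k) (z k))"
    proof (rule closure_hull_outer_prod_nonneg[OF Z])
      fix w assume "w \<in> G"
      \<comment> \<open>The minimiser of the quadratic on the fibre over \<open>w\<close>, where the square vanishes.\<close>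
      define v where "v = - (L *v w)"
      have "v \<bullet> (P *v v) \<le> v \<bullet> (E *v v)"
        using \<open>\<epsilon> > 0\<close> by (simp add: E_form)
      moreover have "v \<bullet> (E *v v) + 2 * (v \<bullet> (R *v w)) + w \<bullet> (S *v w) = w \<bullet> (T *v w)"
        using square[of v w] by (simp add: v_def)
      ultimately show "0 \<le> w \<bullet> (T *v w)"
        using nonneg[OF \<open>w \<in> G\<close>, of v] by linarith
    qed
    also have "\<dots> = (\<Sum>k\<in>I. z k \<bullet> (T *v z k))"
      by (simp add: inner_sum_right inner_outer_prod)
    also have "\<dots> \<le> (\<Sum>k\<in>I. y k \<bullet> (E *v y k) + 2 * (y k \<bullet> (R *v z k)) + z k \<bullet> (S *v z k))"
      by (intro sum_mono) (simp add: square E_nonneg)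
    also have "\<dots> = (\<Sum>k\<in>I. y k \<bullet> (P *v y k) + 2 * (y k \<bullet> (R *v z k)) + z k \<bullet> (S *v z k))
        + \<epsilon> * (\<Sum>k\<in>I. y k \<bullet> y k)"
      by (simp add: E_form sum.distrib sum_distrib_left)
    finally show ?thesis .
  qed
  define Y where "Y = (\<Sum>k\<in>I. y k \<bullet> y k)"
  have "Y \<ge> 0" by (simp add: Y_def sum_nonneg)
  show ?thesis
  proof (rule field_le_epsilon)
    fix e :: real assume "e > 0"
    with \<open>Y \<ge> 0\<close> have "e / (Y + 1) * Y \<le> e" "e / (Y + 1) > 0"
      by (auto simp: field_simps)
    with perturbed[of "e / (Y + 1)"]
    show "0 \<le> (\<Sum>k\<in>I. y k \<bullet> (P *v y k) + 2 * (y k \<bullet> (R *v z k)) + z k \<bullet> (S *v z k)) + e"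
      unfolding Y_def[symmetric] by linarith
  qed
qed

section \<open>Block vectors and block matrices\<close>

lemma sum_UNIV_sum_type:
  fixes h :: "'a::finite + 'b::finite \<Rightarrow> 'c::comm_monoid_add"
  shows "(\<Sum>i\<in>UNIV. h i) = (\<Sum>k\<in>UNIV. h (Inl k)) + (\<Sum>k\<in>UNIV. h (Inr k))"
  by (subst UNIV_Plus_UNIV[symmetric], subst sum.Plus) simp_all

lemma inner_vstack: "vstack v w \<bullet> vstack v' w' = v \<bullet> v' + w \<bullet> w'"
  by (simp add: inner_vec_def sum_UNIV_sum_type vstack_def)

lemma block_mat_mult_vstack:
  "block_mat P Q R S *v vstack v w = vstack (P *v v + Q *v w) (R *v v + S *v w)"
  by (simp add: vec_eq_iff block_mat_def vstack_def matrix_vector_mult_def sum_UNIV_sum_type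
      split: sum.split)

lemma vstack_cases:
  obtains v w where "x = vstack v w"
proof
  show "x = vstack (\<chi> i. x $ Inl i) (\<chi> i. x $ Inr i)"
    by (simp add: vec_eq_iff vstack_def split: sum.split)
qed

lemma vstack_eq_iff: "vstack v w = vstack v' w' \<longleftrightarrow> v = v' \<and> w = w'"
  by (auto simp: vec_eq_iff vstack_def split: sum.splits)

lemma block_mat_eq_iff:
  "block_mat P Q R S = block_mat P' Q' R' S' \<longleftrightarrow> P = P' \<and> Q = Q' \<and> R = R' \<and> S = S'"
proof
  assume eq: "block_mat P Q R S = block_mat P' Q' R' S'"
  have "vstack (P $ k) (Q $ k) = vstack (P' $ k) (Q' $ k)" for k
    using arg_cong[OF eq, of "\<lambda>M. M $ Inl k"] by (simp add: block_mat_def)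
  moreover have "vstack (R $ k) (S $ k) = vstack (R' $ k) (S' $ k)" for k
    using arg_cong[OF eq, of "\<lambda>M. M $ Inr k"] by (simp add: block_mat_def)
  ultimately show "P = P' \<and> Q = Q' \<and> R = R' \<and> S = S'"
    unfolding vstack_eq_iff by (simp add: vec_eq_iff)
qed simp

lemma sum_vstack: "(\<Sum>k\<in>I. vstack (v k) (w k)) = vstack (sum v I) (sum w I)"
  by (simp add: vec_eq_iff vstack_def split: sum.split)

lemma sum_outer_prod_vstack:
  "(\<Sum>k\<in>I. outer_prod (vstack (v k) (w k)) (vstack (v' k) (w' k))) =
   block_mat (\<Sum>k\<in>I. outer_prod (v k) (v' k)) (\<Sum>k\<in>I. outer_prod (v k) (w' k))
             (\<Sum>k\<in>I. outer_prod (w k) (v' k)) (\<Sum>k\<in>I. outer_prod (w k) (w' k))"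
  by (simp add: vec_eq_iff block_mat_def vstack_def outer_prod_def split: sum.split)

text \<open>
  The factorisation \<open>psd_imp_sum_outer_prod\<close> read block by block: a positive semidefinite lifted
  matrix is a matrix of second moments of finitely many points \<open>(t, v, y)\<close>. The first coordinates
  \<open>t\<close> may be negative or zero, so the \<open>v\<close> cannot be rescaled to points of \<open>UU\<close>; the
  last equation is what remains of the link to \<open>UU\<close>.
\<close>

lemma bordered_psd_imp_moments:
  fixes x :: "real^'n" and u :: "real^'q"
  assumes "bordered (vstack u x) (block_mat U (transpose Psi) Psi X) \<in> psd_mats"
  obtains m :: nat and t v y where
    "(\<Sum>k<m. (t k)\<^sup>2) = 1" "(\<Sum>k<m. t k *\<^sub>R v k) = u" "(\<Sum>k<m. t k *\<^sub>R y k) = x"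
    "(\<Sum>k<m. outer_prod (v k) (v k)) = U" "(\<Sum>k<m. outer_prod (y k) (v k)) = Psi"
    "(\<Sum>k<m. outer_prod (y k) (y k)) = X"
    "(\<Sum>k<m. outer_prod (vstack (vec (t k)) (v k)) (vstack (vec (t k)) (v k))) = bordered u U"
proof -
  obtain m :: nat and p where p:
    "bordered (vstack u x) (block_mat U (transpose Psi) Psi X) = (\<Sum>k<m. outer_prod (p k) (p k))"
    using psd_imp_sum_outer_prod[OF assms] by blast
  have "\<exists>\<tau> v y. p k = vstack (vec \<tau>) (vstack v y)" for k
  proof -
    obtain a :: "real^unit" and q where "p k = vstack a q" by (rule vstack_cases)
    moreover obtain v :: "real^'q" and y :: "real^'n" where "q = vstack v y" by (rule vstack_cases)
    moreover have "a = vec (a $ ())" by (simp add: vec_eq_iff)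
    ultimately show ?thesis by metis
  qed
  then obtain t v y where tvy: "\<And>k. p k = vstack (vec (t k)) (vstack (v k) (y k))"
    by metis
  have blocks: "mat 1 = (\<Sum>k<m. outer_prod (vec (t k)) (vec (t k)) :: real^unit^unit)"
    "(\<chi> i. vstack u x) = (\<Sum>k<m. outer_prod (vec (t k) :: real^unit) (vstack (v k) (y k)))"
    "U = (\<Sum>k<m. outer_prod (v k) (v k))" "Psi = (\<Sum>k<m. outer_prod (y k) (v k))"
    "X = (\<Sum>k<m. outer_prod (y k) (y k))"
    using p by (simp_all add: bordered_def tvy sum_outer_prod_vstack block_mat_eq_iff)
  have one: "(\<Sum>k<m. (t k)\<^sup>2) = 1"
    using arg_cong[OF blocks(1), of "\<lambda>W. W $ () $ ()"]
    by (simp add: mat_def outer_prod_def power2_eq_square)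
  have "vstack u x = (\<Sum>k<m. vstack (t k *\<^sub>R v k) (t k *\<^sub>R y k))"
    using arg_cong[OF blocks(2), of "\<lambda>W. W $ ()"]
    by (simp add: vec_eq_iff outer_prod_def vstack_def split_sum_all)
  then have first: "u = (\<Sum>k<m. t k *\<^sub>R v k)" "x = (\<Sum>k<m. t k *\<^sub>R y k)"
    by (simp_all add: sum_vstack vstack_eq_iff)
  have "(\<Sum>k<m. outer_prod (vstack (vec (t k)) (v k)) (vstack (vec (t k)) (v k))) = bordered u U"
    unfolding bordered_def sum_outer_prod_vstack block_mat_eq_iff
    using blocks(1,3) by (auto simp: vec_eq_iff outer_prod_def first mult.commute)
  then show ?thesis
    by (rule that[OF one first[symmetric] blocks(3-5)[symmetric]])
qed

section \<open>The relaxation is bounded by every concave Lagrangian\<close>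

theorem theorem15:
  fixes As :: "'m::finite \<Rightarrow> real^'n^'n" and as :: "'m \<Rightarrow> real^'n" and b :: "real^'m"
    and XX :: "(real^'n) set" and UU :: "(real^'q) set"
    and A :: "real^'n^'n" and B :: "real^'n^'q" and C :: "real^'q^'q"
    and a :: "real^'n" and c :: "real^'q"
    and CC :: "(real^(unit + ('q + 'n))^(unit + ('q + 'n))) set"
    and f :: "real^'n \<Rightarrow> real" and g :: "real^'n \<Rightarrow> ereal"
    and gc :: "real^'n \<Rightarrow> real^'m \<Rightarrow> real" and TT :: "(real^'m) set"
  assumes As_sym: "\<And>i. As i \<in> sym_mats"
    and As_ker: "{X \<in> psd_mats. quad_op As as X 0 = 0} = {0}"
    and XX_def: "XX = {x. quad_op As as (outer_prod x x) x = b}"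
    and UU: "UU \<noteq> {}" "compact UU" "convex UU"
    and A_sym: "A \<in> sym_mats" and C_sym: "C \<in> sym_mats"
    and f_def: "\<And>x. f x = x \<bullet> (A *v x) + 2 * (a \<bullet> x)
        + (SUP u\<in>UU. 2 * (u \<bullet> (B *v x)) + u \<bullet> (C *v u) + 2 * (c \<bullet> u))"
    and CC: "closed CC" "convex CC" "CC \<subseteq> psd_mats" "lift_hull (stacked_times UU XX) \<subseteq> CC"
    and g_def: "\<And>x. g x = Sup {ereal (A \<odot> X + 2 * (a \<bullet> x) + 2 * (transpose B \<odot> Psi)
          + C \<odot> U + 2 * (c \<bullet> u)) | (Psi :: real^'q^'n) u U X.
        U \<in> sym_mats \<and> X \<in> sym_mats
        \<and> bordered (vstack u x) (block_mat U (transpose Psi) Psi X) \<in> CC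
        \<and> bordered u U \<in> lift_hull UU
        \<and> quad_op As as X x = b}"
    and gc_def: "\<And>x l. gc x l = f x - l \<bullet> (quad_op As as (outer_prod x x) x - b)"
    and TT_def: "TT = {l. concave_on UNIV (\<lambda>x. gc x l)}"
  shows "\<forall>x. \<forall>l\<in>TT. g x \<le> ereal (gc x l)"
proof (intro allI ballI)
  fix x :: "real^'n" and l :: "real^'m"
  assume "l \<in> TT"
  define Q where "Q = A - (\<Sum>i\<in>UNIV. l $ i *\<^sub>R As i)"
  define r where "r = 2 *\<^sub>R a - (\<Sum>i\<in>UNIV. l $ i *\<^sub>R as i)"
  \<comment> \<open>An identity in independent \<open>W\<close> and \<open>w\<close>: it is used both for the rank-one matrices in
    \<open>gc\<close> and for the relaxed matrix \<open>X\<close>.\<close>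
  have lagrangian: "A \<bullet> W + 2 * (a \<bullet> w) - l \<bullet> (quad_op As as W w - b) = Q \<bullet> W + r \<bullet> w + l \<bullet> b"
    for W w
    by (simp add: Q_def r_def inner_diff_left inner_diff_right inner_sum_left
        inner_vec_def[of l "\<chi> i. _ i"] quad_op_def mat_inner_eq_inner
        sum.distrib distrib_left)
  obtain d where d: "\<And>y. gc y l \<le> gc x l + d \<bullet> (y - x)"
    using concave_on_supergradient[of "\<lambda>y. gc y l" x] \<open>l \<in> TT\<close> TT_def by auto
  define \<gamma> where "\<gamma> = gc x l - d \<bullet> x - l \<bullet> b"
  have bound: "y \<bullet> (Q *v y) + (r - d) \<bullet> y + 2 * (w \<bullet> (B *v y)) + w \<bullet> (C *v w) + 2 * (c \<bullet> w) \<le> \<gamma>"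
    if "w \<in> UU" for w y
  proof -
    let ?h = "\<lambda>w. 2 * (w \<bullet> (B *v y)) + w \<bullet> (C *v w) + 2 * (c \<bullet> w)"
    have "continuous_on UU ?h"
      by (intro continuous_intros matrix_vector_mult_linear_continuous_on)
    then have "bdd_above (?h ` UU)"
      by (intro bounded_imp_bdd_above compact_imp_bounded compact_continuous_image UU)
    then have "?h w \<le> (SUP w\<in>UU. ?h w)"
      using that by (intro cSUP_upper)
    moreover have "gc y l = y \<bullet> (Q *v y) + r \<bullet> y + l \<bullet> b + (SUP w\<in>UU. ?h w)"
      using lagrangian[of "outer_prod y y" y] by (simp add: gc_def f_def inner_outer_prod)
    ultimately show ?thesis
      using d[of y] by (simp add: \<gamma>_def inner_diff_left inner_diff_right)
  qed
  \<comment> \<open>\<open>R\<close> and \<open>S\<close> homogenise the slack of \<open>bound\<close>: the constant \<open>\<gamma>\<close> and the linear terms become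
    quadratic in \<open>(t, w, y)\<close>, and \<open>t = 1\<close> gives the slack back.\<close>
  define R :: "real^(unit + 'q)^'n"
    where "R = (\<chi> i. vstack (vec ((d - r) $ i / 2)) (- transpose B $ i))"
  define S :: "real^(unit + 'q)^(unit + 'q)"
    where "S = block_mat (mat \<gamma>) (\<chi> i. - c) (\<chi> i j. - c $ i) (- C)"
  have form: "y \<bullet> (- Q *v y) + 2 * (y \<bullet> (R *v vstack (vec t) w))
        + vstack (vec t) w \<bullet> (S *v vstack (vec t) w)
      = - (Q \<bullet> outer_prod y y) + (d - r) \<bullet> (t *\<^sub>R y) - 2 * (transpose B \<bullet> outer_prod y w)
        + \<gamma> * t\<^sup>2 - 2 * (c \<bullet> (t *\<^sub>R w)) - C \<bullet> outer_prod w w" for t y w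
  proof -
    have R_mult: "R *v vstack (vec t) w = (t / 2) *\<^sub>R (d - r) - transpose B *v w"
      by (simp add: vec_eq_iff R_def matrix_vector_mult_def vstack_def sum_UNIV_sum_type
          sum_negf transpose_def)
    have S_mult:
      "S *v vstack (vec t) w = vstack (vec (\<gamma> * t - c \<bullet> w)) (- t *\<^sub>R c - C *v w)"
      unfolding S_def block_mat_mult_vstack vstack_eq_iff
      by (simp add: vec_eq_iff matrix_vector_mult_def mat_def inner_vec_def sum_negf)
    have Q_mult: "- Q *v y = - (Q *v y)"
      by (simp add: vec_eq_iff matrix_vector_mult_def sum_negf)
    have "vec t \<bullet> (vec s :: real^unit) = t * s" for s
      by (simp add: inner_vec_def)
    then show ?thesis
      unfolding R_mult S_mult Q_mult inner_vstack inner_outer_prod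
      by (simp add: inner_diff_right inner_diff_left inner_commute[of y d] inner_commute[of y r]
          inner_commute[of w c] power2_eq_square inner_add_right algebra_simps del: transpose_matrix_vector)
  qed
  have "A \<odot> X + 2 * (a \<bullet> x) + 2 * (transpose B \<odot> Psi) + C \<odot> U + 2 * (c \<bullet> u) \<le> gc x l"
    if psd: "bordered (vstack u x) (block_mat U (transpose Psi) Psi X) \<in> CC"
      and hull: "bordered u U \<in> lift_hull UU" and feas: "quad_op As as X x = b"
    for Psi :: "real^'q^'n" and u U X
  proof -
    have "bordered (vstack u x) (block_mat U (transpose Psi) Psi X) \<in> psd_mats"
      using psd CC(3) by blast
    then obtain m :: nat and t v y where moments:
      "(\<Sum>k<m. (t k)\<^sup>2) = 1" "(\<Sum>k<m. t k *\<^sub>R v k) = u" "(\<Sum>k<m. t k *\<^sub>R y k) = x"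
      "(\<Sum>k<m. outer_prod (v k) (v k)) = U" "(\<Sum>k<m. outer_prod (y k) (v k)) = Psi"
      "(\<Sum>k<m. outer_prod (y k) (y k)) = X"
      "(\<Sum>k<m. outer_prod (vstack (vec (t k)) (v k)) (vstack (vec (t k)) (v k))) = bordered u U"
      by (rule bordered_psd_imp_moments)
    let ?z = "\<lambda>k. vstack (vec (t k)) (v k) :: real^(unit + 'q)"
    have "0 \<le> (\<Sum>k<m. y k \<bullet> (- Q *v y k) + 2 * (y k \<bullet> (R *v ?z k)) + ?z k \<bullet> (S *v ?z k))"
    proof (rule sum_quadratic_nonneg_fibred)
      have "Q \<in> sym_mats"
        unfolding Q_def by (intro sym_mats_diff sym_mats_sum sym_mats_scaleR A_sym As_sym)
      from sym_mats_scaleR[OF this, of "- 1"] show "- Q \<in> sym_mats" by simp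
      show "vstack (vec 1) ` UU \<noteq> {}" using UU by simp
      show "(\<Sum>k<m. outer_prod (?z k) (?z k))
          \<in> closure (convex hull (\<lambda>z. outer_prod z z) ` vstack (vec 1) ` UU)"
        using hull by (simp add: moments(7) lift_hull_def image_image)
    next
      fix z :: "real^(unit + 'q)" and y :: "real^'n"
      assume "z \<in> vstack (vec 1) ` UU"
      then obtain w where "z = vstack (vec 1) w" "w \<in> UU" by blast
      moreover have "y \<bullet> (transpose B *v w) = w \<bullet> (B *v y)"
        by (metis dot_lmul_matrix inner_commute transpose_matrix_vector)
      ultimately show "0 \<le> y \<bullet> (- Q *v y) + 2 * (y \<bullet> (R *v z)) + z \<bullet> (S *v z)"
        using bound[of w y]
        by (simp only: form inner_outer_prod) (simp add: inner_diff_left)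
    qed
    also have "\<dots> = - (Q \<bullet> X) + (d - r) \<bullet> x - 2 * (transpose B \<bullet> Psi) + \<gamma> - 2 * (c \<bullet> u) - C \<bullet> U"
      unfolding form sum.distrib sum_subtractf sum_negf sum_distrib_left[symmetric]
        inner_sum_right[symmetric] moments
      by simp
    finally show ?thesis
      using lagrangian[of X x] by (simp add: feas \<gamma>_def mat_inner_eq_inner inner_diff_left)
  qed
  then show "g x \<le> ereal (gc x l)"
    unfolding g_def by (intro Sup_least) auto
qed

end
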